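(* Let $\mathscr{B}\subseteq\mathbb{N}\setminus\{1\}$ be a primitive set that contains an infinite pairwise coprime subset. Then $\mathbb{A}_{\mathscr{B}}$ admits only trivial automorphisms, i.e. $\mathrm{Aut}(\mathbb{A}_{\mathscr{B}})=\{\sigma^n:n\in\mathbb{Z}\}$.
   Context: A set $\mathscr{B}\subset\mathbb{N}$ is primitive if $b\nmid b'$ for all distinct $b,b'\in\mathscr{B}$. $\sigma$ is the left shift on $\{0,1\}^{\mathbb{Z}}$, $(\sigma x)[n]=x[n+1]$. For a subshift (closed $\sigma$-invariant subset) $X\subseteq\{0,1\}^{\mathbb{Z}}$, $\mathrm{Aut}(X)$ is the group of all homeomorphisms $X\to X$ commuting with $\sigma$. A set $A\subset\mathbb{Z}$ is $\mathscr{B}$-admissible if for every $b\in\mathscr{B}$ one has $|A \bmod b|<b$; $\mathbb{A}_{\mathscr{B}}$ is the subshift of all $x\in\{0,1\}^{\mathbb{Z}}$ whose support $\{n\in\mathbb{Z}:x[n]\neq0\}$ is $\mathscr{B}$-admissible. *)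

theory Defs
  imports "HOL-Analysis.Analysis"
begin

text \<open>
  The full shift \<open>{0,1}\<^sup>\<int>\<close> is the type \<^typ>\<open>int \<Rightarrow> bool\<close>, with
  \<^const>\<open>True\<close> for the symbol 1 and \<^const>\<open>False\<close> for 0. The library's topology on
  \<^typ>\<open>bool\<close> is discrete and its topology on function types is the product topology.
\<close>

definition shift :: "(int \<Rightarrow> bool) \<Rightarrow> (int \<Rightarrow> bool)" where
  "shift x = (\<lambda>n. x (n + 1))"

definition int_iterate :: "('a \<Rightarrow> 'a) \<Rightarrow> int \<Rightarrow> 'a \<Rightarrow> 'a" where
  "int_iterate f n = (if 0 \<le> n then f ^^ nat n else inv f ^^ nat (- n))"

definition subshift :: "(int \<Rightarrow> bool) set \<Rightarrow> bool" where
  "subshift X \<longleftrightarrow> closed X \<and> shift ` X = X"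

text \<open>
  An automorphism is a map defined on \<open>X\<close> only; it is represented by the function that is
  \<^const>\<open>undefined\<close> outside \<open>X\<close>, so that equality of automorphisms is equality on \<open>X\<close>.
\<close>

definition Aut :: "(int \<Rightarrow> bool) set \<Rightarrow> ((int \<Rightarrow> bool) \<Rightarrow> (int \<Rightarrow> bool)) set" where
  "Aut X = {f \<in> extensional X.
     (\<exists>g. homeomorphism X X f g) \<and> (\<forall>x\<in>X. f (shift x) = shift (f x))}"

definition primitive :: "nat set \<Rightarrow> bool" where
  "primitive B \<longleftrightarrow> (\<forall>b\<in>B. \<forall>b'\<in>B. b \<noteq> b' \<longrightarrow> \<not> b dvd b')"

definition admissible :: "nat set \<Rightarrow> int set \<Rightarrow> bool" where
  "admissible B A \<longleftrightarrow> (\<forall>b\<in>B. card ((\<lambda>n. n mod int b) ` A) < b)"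

definition support :: "(int \<Rightarrow> bool) \<Rightarrow> int set" where
  "support x = {n. x n}"

definition admissible_shift :: "nat set \<Rightarrow> (int \<Rightarrow> bool) set" where
  "admissible_shift B = {x. admissible B (support x)}"

lemma bij_shift: "bij shift"
  by (rule o_bij[where g = "\<lambda>x n. x (n - 1)"]) (auto simp: shift_def fun_eq_iff)

lemma int_iterate_shift: "int_iterate shift k x = (\<lambda>n. x (n + k))"
proof -
  have inv: "inv shift = (\<lambda>x n. x (n - 1))"
    by (rule inv_equality) (auto simp: shift_def)
  have "(shift ^^ m) x = (\<lambda>n. x (n + int m))" for m x
    by (induction m) (auto simp: shift_def fun_eq_iff algebra_simps)
  moreover have "(inv shift ^^ m) x = (\<lambda>n. x (n - int m))" for m x
    unfolding inv by (induction m) (auto simp: fun_eq_iff algebra_simps)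
  ultimately show ?thesis
    by (simp add: int_iterate_def)
qed

lemma admissible_iff_omits_residue:
  assumes "0 \<notin> B"
  shows "admissible B A \<longleftrightarrow> (\<forall>b\<in>B. \<exists>r\<in>{0..<int b}. \<forall>n\<in>A. n mod int b \<noteq> r)"
proof -
  have "card ((\<lambda>n. n mod int b) ` A) < b \<longleftrightarrow> (\<exists>r\<in>{0..<int b}. \<forall>n\<in>A. n mod int b \<noteq> r)"
    if "b \<in> B" for b
  proof -
    have b: "0 < b"
      using that assms by (metis gr0I)
    let ?R = "(\<lambda>n. n mod int b) ` A"
    have sub: "?R \<subseteq> {0..<int b}"
      using b by auto
    have "card ?R < b \<longleftrightarrow> ?R \<noteq> {0..<int b}"
    proof
      assume "?R \<noteq> {0..<int b}"
      then have "card ?R < card {0..<int b}"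
        using sub by (intro psubset_card_mono) auto
      then show "card ?R < b" by simp
    qed auto
    also have "\<dots> \<longleftrightarrow> (\<exists>r\<in>{0..<int b}. r \<notin> ?R)"
      using sub by blast
    finally show ?thesis unfolding image_iff by metis
  qed
  then show ?thesis by (simp add: admissible_def)
qed

lemma subshift_admissible_shift:
  assumes "0 \<notin> B"
  shows "subshift (admissible_shift B)"
  unfolding subshift_def
proof
  have coord: "closed {x :: int \<Rightarrow> bool. \<not> x n}" for n
  proof -
    have "closed ((\<lambda>x :: int \<Rightarrow> bool. x n) -` {False})"
      by (intro closed_vimage continuous_on_product_coordinates closed_singleton)
    then show ?thesis by (simp add: vimage_def)
  qed
  have "closed (\<Inter>b\<in>B. \<Union>r\<in>{0..<int b}.
      \<Inter>n\<in>{n. n mod int b = r}. {x :: int \<Rightarrow> bool. \<not> x n})"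
    by (intro closed_INT closed_UN ballI coord finite_atLeastLessThan_int)
  also have "\<dots> = admissible_shift B"
  proof -
    have "(\<forall>n. n mod int b = r \<longrightarrow> \<not> x n) \<longleftrightarrow> (\<forall>n. x n \<longrightarrow> n mod int b \<noteq> r)" for b r x
      by blast
    then show ?thesis
      unfolding admissible_shift_def admissible_iff_omits_residue[OF assms] support_def
      by (simp add: set_eq_iff)
  qed
  finally show "closed (admissible_shift B)" .
next
  have *: "admissible B ((\<lambda>n. n + k) ` A)" if "admissible B A" for k A
    unfolding admissible_def
  proof
    fix b assume b: "b \<in> B"
    let ?m = "\<lambda>n. n mod int b"
    have "0 < b"
      using b assms by (metis gr0I)
    then have "?m ` A \<subseteq> {0..<int b}"
      by auto
    then have fin: "finite (?m ` A)"
      by (rule finite_subset) simp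
    have eq: "?m ` (\<lambda>n. n + k) ` A = (\<lambda>n. (n + k) mod int b) ` ?m ` A"
      unfolding image_image by (intro image_cong refl mod_add_left_eq[symmetric])
    have "card (?m ` (\<lambda>n. n + k) ` A) \<le> card (?m ` A)"
      unfolding eq by (rule card_image_le[OF fin])
    then show "card (?m ` (\<lambda>n. n + k) ` A) < b"
      using that b unfolding admissible_def by (meson le_less_trans)
  qed
  have supp: "support (\<lambda>n. x (n + k)) = (\<lambda>n. n - k) ` support x" for x k
  proof
    show "support (\<lambda>n. x (n + k)) \<subseteq> (\<lambda>n. n - k) ` support x"
    proof
      fix n assume "n \<in> support (\<lambda>n. x (n + k))"
      then show "n \<in> (\<lambda>n. n - k) ` support x"
        by (intro image_eqI[of _ _ "n + k"]) (simp_all add: support_def)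
    qed
  qed (auto simp: support_def)
  have inX: "(\<lambda>n. x (n + k)) \<in> admissible_shift B" if "x \<in> admissible_shift B" for x k
    using *[of "support x" "- k"] that by (simp add: admissible_shift_def supp[of x k])
  show "shift ` admissible_shift B = admissible_shift B"
  proof
    show "shift ` admissible_shift B \<subseteq> admissible_shift B"
      unfolding shift_def by (intro image_subsetI inX)
    show "admissible_shift B \<subseteq> shift ` admissible_shift B"
    proof
      fix x assume "x \<in> admissible_shift B"
      then have "(\<lambda>n. x (n + - 1)) \<in> admissible_shift B" by (rule inX)
      then show "x \<in> shift ` admissible_shift B"
        by (rule rev_image_eqI) (simp add: shift_def)
    qed
  qed
qed

end

theory Submission
  imports Defs "HOL-Number_Theory.Cong"
begin

text \<open>
  Let \<open>F\<close> be an automorphism with inverse \<open>G\<close>, and call the configuration with a single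
  \<open>1\<close>, at the origin, the point. The proof rests on admissible configurations that are saturated
  modulo one large \<open>b\<close> in \<open>B\<close>: all residues modulo \<open>b\<close> but one occur in the support.
  The image of such a configuration must also omit a residue modulo \<open>b\<close>, which leaves no room
  for \<open>F\<close> to create anything.

  First, saturate with points that are very far apart. By continuity \<open>F\<close> acts near each of them
  as it does on the point, so if the image of the point had two ones, the image of the saturated
  configuration would meet every residue modulo \<open>b\<close> (\<open>image_of_point_at_most_one\<close>). As the
  image of the point is not zero, \<open>F\<close> moves the point by some power of the shift, and after
  dividing by that power both \<open>F\<close> and \<open>G\<close> fix the point. Second, if such a map produced a
  \<open>1\<close> at a place \<open>n\<close> where \<open>x\<close> has a \<open>0\<close>, it would do so already for a finite
  part of \<open>x\<close>. Adding far away points, that part can be saturated so that just the residue of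
  \<open>n\<close> is missing; then the image contains the added points and \<open>n\<close>, hence meets all residues
  (\<open>endomorphism_fixing_point_le\<close>). So neither \<open>F\<close> nor \<open>G\<close> enlarges a support, and
  \<open>F\<close> is the identity.

  That such saturated sets exist (\<open>extend_to_cover\<close>) is where the hypotheses on \<open>B\<close> enter.
  The added points are prescribed modulo \<open>b\<close>, and must not be spread modulo any other member
  \<open>d\<close> of \<open>B\<close>. By primitivity some prime has a larger exponent in \<open>d\<close> than in \<open>b\<close>, and
  the freedom in the choice of digits for that prime keeps at least half of the residues modulo
  \<open>d\<close> unused. This suffices for all \<open>d\<close> larger than twice the number of points to which the
  new ones are added. For the finitely many smaller \<open>d\<close>, the infinite coprime subset supplies a
  \<open>b\<close> coprime to them, and then the added points can be put into a class modulo \<open>d\<close> that is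
  already in use.
\<close>

section \<open>Integers with few residues\<close>

lemma int_dvd_if_prime_powers_dvd:
  fixes d :: nat and z :: int
  assumes "d > 0"
    and "\<And>p. prime p \<Longrightarrow> p dvd d \<Longrightarrow> int p ^ multiplicity p d dvd z"
  shows "int d dvd z"
proof (cases "z = 0")
  case False
  have "d dvd nat \<bar>z\<bar>"
  proof (rule multiplicity_le_imp_dvd)
    fix p :: nat assume p: "prime p"
    show "multiplicity p d \<le> multiplicity p (nat \<bar>z\<bar>)"
    proof (cases "p dvd d")
      case True
      have "int (p ^ multiplicity p d) dvd z"
        using assms(2)[OF p True] by simp
      then have "p ^ multiplicity p d dvd nat \<bar>z\<bar>"
        by (simp only: dvd_nat_abs_iff)
      then show ?thesis
        using False p by (subst power_dvd_iff_le_multiplicity[symmetric]) auto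
    qed (simp add: not_dvd_imp_multiplicity_0)
  qed (use assms in auto)
  then show ?thesis by (simp only: dvd_nat_abs_iff)
qed simp

text \<open>
  A residue class modulo \<open>b\<close> is represented by arbitrarily large integers that are
  little spread modulo the other \<open>d \<le> N\<close>. If \<open>p\<^sup>v\<close> is the exact power of a prime \<open>p\<close>
  dividing \<open>b\<close>, then a representative may be prescribed modulo a high power of \<open>p\<close>, as
  long as its class modulo \<open>p\<^sup>v\<close> is right; the prescribed value is the residue of \<open>t\<close> in
  \<open>[0, p\<^sup>v)\<close>. The representatives then occupy only a fraction \<open>1/p\<close> of the classes
  modulo \<open>p\<^bsup>v+1\<^esup>\<close>, and for \<open>p\<close> not dividing \<open>b\<close> they vanish modulo the high power.
\<close>

lemma sparse_lift:
  fixes b N t Z :: nat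
  assumes "b > 0" "b \<le> N"
  shows "\<exists>y>Z. [y = t] (mod b) \<and> (\<forall>d\<in>{1..N}. coprime d b \<longrightarrow> d dvd y) \<and>
    (\<forall>p. prime p \<and> p \<le> N \<longrightarrow>
      y mod p ^ Suc (multiplicity p b) < p ^ multiplicity p b)"
proof -
  let ?v = "\<lambda>p. multiplicity p b"
  let ?P = "{p. prime p \<and> p \<le> N}"
  \<comment> \<open>\<open>p ^ E\<close> is the high power: it exceeds every power of \<open>p\<close> that divides some \<open>d \<le> N\<close>.\<close>
  define E where "E = Suc N"
  have mult_less: "multiplicity p d < E" if "prime p" "d \<in> {1..N}" for p d :: nat
  proof -
    have "p ^ multiplicity p d \<le> d"
      using that by (intro dvd_imp_le multiplicity_dvd) auto
    moreover have "multiplicity p d < p ^ multiplicity p d"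
      using prime_gt_1_nat[OF that(1)] by (intro power_gt_expt) simp
    ultimately show ?thesis using that(2) by (auto simp: E_def)
  qed
  have "\<exists>x. \<forall>p\<in>?P. [x = t mod p ^ ?v p] (mod p ^ E)"
    by (intro chinese_remainder_nat) (auto simp: primes_coprime)
  then obtain x where x: "\<And>p. prime p \<Longrightarrow> p \<le> N \<Longrightarrow> [x = t mod p ^ ?v p] (mod p ^ E)"
    by auto
  define M where "M = (\<Prod>p\<in>?P. p ^ E)"
  define y where "y = x + Suc Z * M"
  have y: "[y = t mod p ^ ?v p] (mod p ^ E)" if p: "prime p" "p \<le> N" for p
  proof -
    have "p ^ E dvd M"
      unfolding M_def using p by (intro dvd_prodI) auto
    then have "[y = x + 0] (mod p ^ E)"
      unfolding y_def by (intro cong_add cong_refl) (simp add: cong_0_iff)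
    then show ?thesis using x[OF p] by (metis add_0_right cong_trans)
  qed
  have "1 \<le> M"
    unfolding M_def by (auto simp: Suc_le_eq prime_gt_0_nat intro!: prod_pos)
  then have "Suc Z * 1 \<le> Suc Z * M" by (rule mult_le_mono2)
  then have "Z < Suc Z * M" by (simp only: mult_1_right Suc_le_eq)
  then have "Z < y" unfolding y_def by (rule trans_less_add2)
  moreover have "[y = t] (mod b)"
  proof -
    have "int b dvd int y - int t"
    proof (rule int_dvd_if_prime_powers_dvd[OF assms(1)])
      fix p assume p: "prime p" "p dvd b"
      then have pN: "p \<le> N" using dvd_imp_le[of p b] assms by linarith
      have "p ^ ?v p dvd p ^ E"
        using mult_less[OF p(1), of b] assms by (intro le_imp_power_dvd) auto
      then have "[y = t mod p ^ ?v p] (mod p ^ ?v p)"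
        by (rule cong_dvd_modulus_nat[OF y[OF p(1) pN]])
      then have "[y = t] (mod p ^ ?v p)" by (simp add: cong_def)
      then have "[int y = int t] (mod int (p ^ ?v p))" by (simp only: cong_int_iff)
      then show "int p ^ ?v p dvd int y - int t" by (simp add: cong_iff_dvd_diff)
    qed
    then have "[int y = int t] (mod int b)" by (simp only: cong_iff_dvd_diff)
    then show ?thesis by (simp only: cong_int_iff)
  qed
  moreover have "\<forall>d\<in>{1..N}. coprime d b \<longrightarrow> d dvd y"
  proof (intro ballI impI)
    fix d assume d: "d \<in> {1..N}" "coprime d b"
    have "int d dvd int y"
    proof (rule int_dvd_if_prime_powers_dvd)
      fix p assume p: "prime p" "p dvd d"
      then have pN: "p \<le> N" using dvd_imp_le[of p d] d(1) by auto
      have "\<not> p dvd b"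
        using p d(2) by (metis coprime_common_divisor not_prime_unit)
      then have "[y = 0] (mod p ^ E)"
        using y[OF p(1) pN] by (simp add: not_dvd_imp_multiplicity_0)
      then have "p ^ multiplicity p d dvd y"
        using mult_less[OF p(1) d(1)] by (meson cong_0_iff dvd_trans le_imp_power_dvd less_imp_le)
      then show "int p ^ multiplicity p d dvd int y" by (simp flip: of_nat_power)
    qed (use d in auto)
    then show "d dvd y" by simp
  qed
  moreover have "\<forall>p. prime p \<and> p \<le> N \<longrightarrow> y mod p ^ Suc (?v p) < p ^ ?v p"
  proof (intro allI impI)
    fix p assume p: "prime p \<and> p \<le> N"
    have pos: "0 < p ^ ?v p" using p by (simp add: prime_gt_0_nat)
    have "p ^ Suc (?v p) dvd p ^ E"
      using mult_less[of p b] p assms by (intro le_imp_power_dvd) auto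
    then have "[y = t mod p ^ ?v p] (mod p ^ Suc (?v p))"
      using y p by (blast intro: cong_dvd_modulus_nat)
    then have "y mod p ^ Suc (?v p) = t mod p ^ ?v p mod p ^ Suc (?v p)"
      by (simp add: cong_def)
    also have "\<dots> \<le> t mod p ^ ?v p" by (rule mod_less_eq_dividend)
    also have "\<dots> < p ^ ?v p" using pos by simp
    finally show "y mod p ^ Suc (?v p) < p ^ ?v p" .
  qed
  ultimately show ?thesis by (intro exI[of _ y] conjI)
qed

text \<open>
  Values that exist beyond every bound can be chosen one after the other, each far beyond the earlier
  ones; so isolation comes for free on top of congruence conditions.
\<close>

lemma spread_out:
  fixes W :: "int set" and m :: int and P :: "'i \<Rightarrow> int \<Rightarrow> bool"
  assumes "finite I" "finite W"
    and "\<And>i Z. i \<in> I \<Longrightarrow> \<exists>n>Z. P i n"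
  shows "\<exists>f. \<forall>i\<in>I. P i (f i) \<and> (\<forall>k\<in>W. m < \<bar>f i - k\<bar>) \<and>
    (\<forall>j\<in>I. i \<noteq> j \<longrightarrow> m < \<bar>f i - f j\<bar>)"
  using assms(1,3)
proof (induction I)
  case (insert i I)
  then obtain f where f: "\<And>i. i \<in> I \<Longrightarrow> P i (f i)"
    "\<And>i k. i \<in> I \<Longrightarrow> k \<in> W \<Longrightarrow> m < \<bar>f i - k\<bar>"
    "\<And>i j. i \<in> I \<Longrightarrow> j \<in> I \<Longrightarrow> i \<noteq> j \<Longrightarrow> m < \<bar>f i - f j\<bar>"
    by (metis insertCI)
  obtain Z where Z: "\<And>k. k \<in> W \<union> f ` I \<Longrightarrow> k \<le> Z"
    using bdd_above_finite[of "W \<union> f ` I"] assms(2) insert.hyps(1)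
    by (auto simp: bdd_above_def)
  obtain n where n: "Z + m < n" "P i n"
    using insert.prems[of i] by blast
  have "m < \<bar>n - k\<bar>" if "k \<in> W \<union> f ` I" for k
    using Z[OF that] n(1) by linarith
  then have far: "m < \<bar>n - k\<bar>" "m < \<bar>k - n\<bar>" if "k \<in> W \<union> f ` I" for k
    using that by (simp_all add: abs_minus_commute)
  show ?case
  proof (intro exI[of _ "f(i := n)"] ballI conjI impI)
    fix j k assume "j \<in> insert i I" "k \<in> insert i I" "j \<noteq> k"
    then show "m < \<bar>(f(i := n)) j - (f(i := n)) k\<bar>"
      using far f(3) insert.hyps(2) by (cases "j = i"; cases "k = i") auto
  qed (use f(1,2) far n(2) insert.hyps(2) in auto)
qed auto

text \<open>
  A prime divides at most one member of a pairwise coprime set, so only finitely many members share a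
  prime with \<open>L\<close>.
\<close>

lemma exists_large_coprime:
  fixes C :: "nat set" and L K :: nat
  assumes "infinite C" "pairwise coprime C" "L > 0"
  shows "\<exists>b\<in>C. K < b \<and> coprime b L"
proof -
  have "\<exists>p. \<forall>c\<in>{c\<in>C. \<not> coprime c L}. prime (p c) \<and> p c dvd c \<and> p c dvd L"
    using prime_factor_nat[of "gcd _ L"]
    by (intro bchoice) (metis (no_types, lifting) coprime_iff_gcd_eq_1 gcd_nat.bounded_iff mem_Collect_eq)
  then obtain p where p: "\<And>c. c \<in> C \<Longrightarrow> \<not> coprime c L \<Longrightarrow> prime (p c) \<and> p c dvd c \<and> p c dvd L"
    by auto
  have "inj_on p {c\<in>C. \<not> coprime c L}"
  proof (rule inj_onI, rule ccontr)
    fix c c' assume c: "c \<in> {c\<in>C. \<not> coprime c L}" "c' \<in> {c\<in>C. \<not> coprime c L}"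
      and eq: "p c = p c'" and ne: "c \<noteq> c'"
    have "coprime c c'" using c ne assms(2) by (auto simp: pairwise_def)
    moreover have "p c dvd c" "p c dvd c'" "prime (p c)"
      using p[of c] p[of c'] c eq by auto
    ultimately show False by (meson coprime_common_divisor not_prime_unit)
  qed
  moreover have "finite (p ` {c\<in>C. \<not> coprime c L})"
    by (rule finite_subset[of _ "{d. d dvd L}"]) (use p assms(3) in auto)
  ultimately have "finite {c\<in>C. \<not> coprime c L}"
    by (rule finite_imageD[rotated])
  then have "infinite (C - {c\<in>C. \<not> coprime c L} - {..K})"
    using assms(1) by simp
  then obtain b where "b \<in> C - {c\<in>C. \<not> coprime c L} - {..K}"
    using infinite_imp_nonempty by blast
  then show ?thesis by (auto simp: not_le intro!: bexI[of _ b])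
qed

text \<open>
  Among the \<open>d\<close> residues, those whose remainder modulo the divisor \<open>q\<close> is below \<open>r\<close>
  come in \<open>d / q\<close> blocks of \<open>r\<close>.
\<close>

lemma card_residues_small_mod_le:
  fixes T :: "int set" and q r d :: nat
  assumes "q dvd d" "d > 0"
    and "\<And>n. n \<in> T \<Longrightarrow> n mod int q < int r"
  shows "card ((\<lambda>n. n mod int d) ` T) \<le> (d div q) * r"
proof -
  have q: "q > 0" using assms(1,2) dvd_pos_nat by blast
  let ?g = "\<lambda>(i, j). int q * i + j"
  let ?D = "{0..<int (d div q)} \<times> {0..<int r}"
  have "(\<lambda>n. n mod int d) ` T \<subseteq> ?g ` ?D"
  proof (rule image_subsetI)
    fix n assume n: "n \<in> T"
    let ?c = "n mod int d"
    have "?c mod int q = n mod int q"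
      using assms(1) by (simp add: mod_mod_cancel)
    then have "0 \<le> ?c mod int q" "?c mod int q < int r"
      using assms(3)[OF n] q by auto
    moreover have "0 \<le> ?c div int q"
      using assms(2) q by (simp add: pos_imp_zdiv_nonneg_iff)
    moreover have "?c div int q < int (d div q)"
    proof -
      have "int q * (?c div int q) \<le> ?c"
        using mult_div_mod_eq[of "int q" ?c] \<open>0 \<le> ?c mod int q\<close> by linarith
      also have "\<dots> < int d" using assms(2) by simp
      also have "int d = int q * int (d div q)"
        using assms(1) by (simp flip: of_nat_mult)
      finally show ?thesis using q by (simp add: mult_less_cancel_left_pos)
    qed
    ultimately show "?c \<in> ?g ` ?D"
      by (intro image_eqI[of _ _ "(?c div int q, ?c mod int q)"]) auto
  qed
  then have "card ((\<lambda>n. n mod int d) ` T) \<le> card (?g ` ?D)"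
    by (intro card_mono) auto
  also have "\<dots> \<le> card ?D" by (intro card_image_le) simp
  finally show ?thesis by simp
qed

lemma card_residues_translate_le:
  fixes T :: "int set" and d :: int
  assumes "d > 0"
  shows "card ((\<lambda>n. n mod d) ` T) \<le> card ((\<lambda>n. (n - a) mod d) ` T)"
proof -
  have "(\<lambda>n. n mod d) ` T = (\<lambda>c. (c + a) mod d) ` (\<lambda>n. (n - a) mod d) ` T"
    unfolding image_image by (intro image_cong refl) (simp add: mod_add_left_eq)
  moreover have "finite ((\<lambda>n. (n - a) mod d) ` T)"
    by (rule finite_subset[of _ "{0..<d}"]) (use assms in auto)
  ultimately show ?thesis by (simp add: card_image_le)
qed

text \<open>
  The arithmetic heart. A finite admissible set \<open>A\<close> that avoids \<open>s\<close> is enlarged by isolated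
  points so that for some large \<open>b\<close> in \<open>B\<close> exactly one residue is still free, namely that
  of \<open>s\<close>: one more point congruent to \<open>s\<close> would destroy admissibility. Here \<open>b\<close> is
  taken coprime to every number up to twice the size of \<open>A\<close>, and the new points are lifts of
  the residues other than that of \<open>s\<close> as in \<open>sparse_lift\<close>, based at a point \<open>a\<close> of
  \<open>A\<close> instead of \<open>0\<close>.

  The other members \<open>d\<close> of \<open>B\<close> keep a free residue for one of three reasons. If \<open>d\<close> is
  large, there are simply too few points. If \<open>d\<close> is at most twice the size of \<open>A\<close>, the new
  points are all congruent to \<open>a\<close> modulo \<open>d\<close>. In between, primitivity gives a prime
  \<open>p\<close> whose exponent in \<open>d\<close> exceeds that in \<open>b\<close>; then the new points take up at most
  \<open>d / p\<close> residues, which is at most half of them, and \<open>A\<close> takes up less than the other half.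
\<close>

lemma extend_to_cover:
  fixes B :: "nat set" and A W :: "int set" and s m :: int and K :: nat
  assumes B: "0 \<notin> B" "1 \<notin> B" "primitive B" and C: "C \<subseteq> B" "infinite C" "pairwise coprime C"
    and A: "finite A" "admissible B A" "s \<notin> A" and W: "finite W"
  shows "\<exists>b\<in>B. \<exists>T. K < b \<and> admissible B (A \<union> T) \<and>
    (\<forall>t. \<not> [t = s] (mod int b) \<longrightarrow> (\<exists>n\<in>T. [n = t] (mod int b))) \<and>
    (\<forall>n\<in>T. \<forall>k\<in>W. m < \<bar>n - k\<bar>) \<and> (\<forall>n\<in>T. \<forall>k\<in>T. n \<noteq> k \<longrightarrow> m < \<bar>n - k\<bar>)"
proof -
  \<comment> \<open>Choosing \<open>b > D\<close> keeps the points of \<open>A\<close> out of the class of \<open>s\<close> modulo \<open>b\<close>.\<close>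
  obtain D where D: "\<And>a. a \<in> A \<Longrightarrow> nat \<bar>a - s\<bar> \<le> D"
    using bdd_above_finite[of "(\<lambda>a. nat \<bar>a - s\<bar>) ` A"] A(1) by (auto simp: bdd_above_def)
  \<comment> \<open>For empty \<open>A\<close> the base point is arbitrary, as no \<open>d \<ge> 1\<close> is then at most \<open>2 * card A\<close>.\<close>
  obtain a where a: "A \<noteq> {} \<Longrightarrow> a \<in> A" by blast
  obtain b where b: "b \<in> C" "K + D < b" and cop: "coprime b (fact (2 * card A))"
    using exists_large_coprime[OF C(2,3), of "fact (2 * card A)" "K + D"] by auto
  then have bB: "b \<in> B" and b0: "b > 0" using C(1) B(1) by auto
  \<comment> \<open>Beyond \<open>N\<close> the number of points alone leaves a residue free.\<close>
  define N where "N = 2 * card A + b"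
  let ?v = "\<lambda>p. multiplicity p b"
  \<comment> \<open>The residues modulo \<open>b\<close> that receive a new point.\<close>
  define I where "I = {0..<b} - {nat (s mod int b)}"
  define P where "P t n \<longleftrightarrow> [n = int t] (mod int b) \<and>
    (\<forall>d\<in>{1..N}. coprime d b \<longrightarrow> int d dvd n - a) \<and>
    (\<forall>p. prime p \<and> p \<le> N \<longrightarrow> (n - a) mod int (p ^ Suc (?v p)) < int (p ^ ?v p))"
    for t n
  have lift: "\<exists>n>Z. P t n" for t :: nat and Z :: int
  proof -
    obtain y where y: "nat (Z - a) < y" "[y = nat ((int t - a) mod int b)] (mod b)"
      "\<And>d. d \<in> {1..N} \<Longrightarrow> coprime d b \<Longrightarrow> d dvd y"
      "\<And>p. prime p \<Longrightarrow> p \<le> N \<Longrightarrow> y mod p ^ Suc (?v p) < p ^ ?v p"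
      using sparse_lift[of b N "nat (Z - a)" "nat ((int t - a) mod int b)"] b0
      by (auto simp: N_def)
    have "[int y = (int t - a) mod int b] (mod int b)"
      using y(2) b0 by (simp flip: cong_int_iff)
    then have "[int y = int t - a] (mod int b)" by (simp add: cong_def)
    then have "[int y + a = int t] (mod int b)"
      by (simp add: cong_iff_dvd_diff algebra_simps)
    moreover have "(int y + a - a) mod int (p ^ Suc (?v p)) < int (p ^ ?v p)"
      if "prime p" "p \<le> N" for p
      using y(4)[OF that] by (simp only: add_diff_cancel_right' zmod_int[symmetric] of_nat_less_iff)
    ultimately have "P t (int y + a)" using y(3) by (auto simp: P_def)
    then show ?thesis using y(1) by (intro exI[of _ "int y + a"]) auto
  qed
  have "finite I" by (simp add: I_def)
  from spread_out[of I W P m, OF this W lift] obtain f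
    where f: "\<And>t. t \<in> I \<Longrightarrow> P t (f t)"
      and sep: "\<And>t k. t \<in> I \<Longrightarrow> k \<in> W \<Longrightarrow> m < \<bar>f t - k\<bar>"
        "\<And>t u. t \<in> I \<Longrightarrow> u \<in> I \<Longrightarrow> t \<noteq> u \<Longrightarrow> m < \<bar>f t - f u\<bar>"
    by metis
  have f_cong: "[f t = int t] (mod int b)" if "t \<in> I" for t
    using f[OF that] unfolding P_def by blast
  define T where "T = f ` I"
  have T: "int d dvd n - a" if "n \<in> T" "d \<in> {1..N}" "coprime d b" for n d
    using f that by (auto simp: T_def P_def)
  have T': "(n - a) mod int (p ^ Suc (?v p)) < int (p ^ ?v p)"
    if "n \<in> T" "prime p" "p \<le> N" for n p
    using f that by (auto simp: T_def P_def)
  have I_card: "card I < b"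
    unfolding I_def using b0 by (subst card_Diff_singleton) (auto simp: nat_less_iff)
  have adm: "admissible B (A \<union> T)"
    unfolding admissible_def
  proof
    fix d assume d: "d \<in> B"
    have d1: "d > 1" using d B(1,2) by (metis nat_neq_iff less_one)
    let ?r = "\<lambda>S. (\<lambda>n. n mod int d) ` S"
    have Ad: "card (?r A) < d" using A(2) d by (simp add: admissible_def)
    have cA: "card (?r A) \<le> card A" using A(1) by (rule card_image_le)
    have Un: "card (?r (A \<union> T)) \<le> card (?r A) + card (?r T)"
      unfolding image_Un by (rule card_Un_le)
    consider "d = b" | "d > N" | "d \<noteq> b" "d \<le> N" "d \<le> 2 * card A" | "d \<noteq> b" "d \<le> N" "d > 2 * card A"
      by linarith
    then show "card (?r (A \<union> T)) < d"
    proof cases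
      case 1
      have "n mod int b \<noteq> s mod int b" if n: "n \<in> A \<union> T" for n
      proof (cases "n \<in> A")
        case True
        then have "n \<noteq> s" "\<bar>n - s\<bar> < int b" using D[OF True] b(2) A(3) by auto
        then have "\<not> int b dvd n - s" using dvd_imp_le_int[of "n - s" "int b"] by auto
        then show ?thesis by (metis mod_eq_dvd_iff)
      next
        case False
        then obtain t where t: "t \<in> I" "n = f t" using n by (auto simp: T_def)
        then have "n mod int b = int t"
          using f_cong[OF t(1)] t(1) by (simp add: cong_def I_def)
        moreover have "int t \<noteq> s mod int b" using t(1) by (auto simp: I_def)
        ultimately show ?thesis by simp
      qed
      then have "?r (A \<union> T) \<subseteq> {0..<int b} - {s mod int b}"
        using 1 b0 by auto
      then have "card (?r (A \<union> T)) \<le> card ({0..<int b} - {s mod int b})"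
        by (intro card_mono) auto
      also have "\<dots> < d" using 1 b0 by (subst card_Diff_singleton) auto
      finally show ?thesis .
    next
      case 2
      have "card (?r T) \<le> card I"
        unfolding T_def image_image by (rule card_image_le[OF \<open>finite I\<close>])
      then show ?thesis using Un cA I_card 2 by (simp add: N_def)
    next
      case 3
      then have "A \<noteq> {}" using d1 by auto
      have "d dvd fact (2 * card A)" using 3 d1 by (intro dvd_fact) auto
      then have "coprime d b" using cop by (meson coprime_commute coprime_divisors dvd_refl)
      then have "?r T \<subseteq> {a mod int d}"
        using T[of _ d] 3 d1 by (auto simp: mod_eq_dvd_iff)
      then have "?r (A \<union> T) = ?r A" using a[OF \<open>A \<noteq> {}\<close>] by auto
      then show ?thesis using Ad by simp
    next
      case 4
      have "\<not> d dvd b" using B(3) 4 d bB by (auto simp: primitive_def)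
      then obtain p where p: "prime p" "?v p < multiplicity p d"
        using multiplicity_le_imp_dvd[of d b] d1 by (metis not_le not_one_less_zero)
      have qd: "p ^ Suc (?v p) dvd d" using p(2) by (intro multiplicity_dvd') auto
      then have "p dvd d" by (meson dvd_trans dvd_power zero_less_Suc)
      then have pN: "p \<le> N" using d1 4(2) dvd_imp_le[of p d] by auto
      have "card (?r T) \<le> card ((\<lambda>n. (n - a) mod int d) ` T)"
        using d1 by (intro card_residues_translate_le) auto
      also have "\<dots> = card ((\<lambda>n. n mod int d) ` (\<lambda>n. n - a) ` T)" by (simp add: image_image)
      also have "\<dots> \<le> d div p ^ Suc (?v p) * p ^ ?v p"
        using qd d1 T'[OF _ p(1) pN] by (intro card_residues_small_mod_le) auto
      finally have "p * card (?r T) \<le> p * (d div p ^ Suc (?v p) * p ^ ?v p)"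
        by (rule mult_le_mono2)
      also have "\<dots> = d" using qd by (metis dvd_div_mult_self mult.assoc mult.commute power_Suc)
      finally have "p * card (?r T) \<le> d" .
      moreover have "2 * card (?r T) \<le> p * card (?r T)"
        using prime_ge_2_nat[OF p(1)] by (rule mult_le_mono1)
      ultimately show ?thesis using Un cA 4 by linarith
    qed
  qed
  have cover: "\<exists>n\<in>T. [n = t] (mod int b)" if t: "\<not> [t = s] (mod int b)" for t
  proof -
    have eq: "int (nat (t mod int b)) = t mod int b" "int (nat (s mod int b)) = s mod int b"
      using b0 by simp_all
    have "nat (t mod int b) \<in> I"
      using t b0 unfolding I_def cong_def Diff_iff singleton_iff
      by (metis atLeastLessThan_iff eq(1,2) le0 of_nat_0_less_iff of_nat_less_iff pos_mod_bound)
    moreover from f_cong[OF this] have "[f (nat (t mod int b)) = t] (mod int b)"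
      using eq by (simp add: cong_def)
    ultimately show ?thesis by (auto simp: T_def)
  qed
  have "K < b" using b(2) by simp
  have sepW: "\<forall>n\<in>T. \<forall>k\<in>W. m < \<bar>n - k\<bar>"
    using sep(1) by (auto simp: T_def)
  have sepT: "\<forall>n\<in>T. \<forall>k\<in>T. n \<noteq> k \<longrightarrow> m < \<bar>n - k\<bar>"
    using sep(2) unfolding T_def by blast
  show ?thesis
    by (intro bexI[OF _ bB] exI[of _ T] conjI allI impI \<open>K < b\<close> adm cover sepW sepT)
qed

section \<open>Endomorphisms of a subshift\<close>

definition shift_endomorphism :: "(int \<Rightarrow> bool) set \<Rightarrow> ((int \<Rightarrow> bool) \<Rightarrow> int \<Rightarrow> bool) \<Rightarrow> bool" where
  "shift_endomorphism X G \<longleftrightarrow>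
    continuous_on X G \<and> G ` X \<subseteq> X \<and> (\<forall>x\<in>X. G (shift x) = shift (G x))"

text \<open>
  A pointwise form of the sliding block code theorem: the radius of the window may depend on
  \<open>x\<close> and \<open>n\<close>. It is just continuity at \<open>x\<close>, because cylinders on finitely many
  coordinates form a neighbourhood base of \<open>x\<close>.
\<close>

lemma continuous_on_imp_locally_determined:
  fixes G :: "(int \<Rightarrow> bool) \<Rightarrow> int \<Rightarrow> bool"
  assumes "continuous_on X G" "x \<in> X"
  shows "\<exists>m. \<forall>y\<in>X. (\<forall>i. \<bar>i\<bar> \<le> m \<longrightarrow> y i = x i) \<longrightarrow> G y n = G x n"
proof -
  have "continuous_on X (\<lambda>y. G y n)"
    using assms(1) by (rule continuous_on_product_then_coordinatewise)
  then obtain U where U: "open U" "U \<inter> X = (\<lambda>y. G y n) -` {G x n} \<inter> X"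
    unfolding continuous_on_open_invariant using open_discrete by metis
  then have "x \<in> U" using assms(2) by auto
  then obtain V where V: "x \<in> Pi\<^sub>E UNIV V" "finite {i. V i \<noteq> UNIV}" "Pi\<^sub>E UNIV V \<subseteq> U"
    using product_topology_open_contains_basis[of "\<lambda>_. euclidean" UNIV U x] U(1)
    by (auto simp: open_fun_def)
  obtain m where m: "\<And>i. V i \<noteq> UNIV \<Longrightarrow> \<bar>i\<bar> \<le> m"
    using bdd_above_finite[of "abs ` {i. V i \<noteq> UNIV}"] V(2) by (auto simp: bdd_above_def)
  show ?thesis
  proof (intro exI[of _ m] ballI impI)
    fix y assume y: "y \<in> X" "\<forall>i. \<bar>i\<bar> \<le> m \<longrightarrow> y i = x i"
    have "y i \<in> V i" for i
      using V(1) y(2) m[of i] by (cases "V i = UNIV") (auto simp: PiE_iff)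
    then have "y \<in> U" using V(3) by auto
    then show "G y n = G x n" using U(2) y(1) by blast
  qed
qed

lemma subshift_shift:
  assumes "subshift X" "x \<in> X"
  shows "shift x \<in> X"
  using assms unfolding subshift_def by blast

lemma shift_endomorphism_translate:
  assumes X: "subshift X" and G: "shift_endomorphism X G" and x: "x \<in> X"
  shows "(\<lambda>n. x (n + k)) \<in> X \<and> G (\<lambda>n. x (n + k)) = (\<lambda>n. G x (n + k))"
proof (induction k rule: int_induct[where k = 0])
  case base
  show ?case using x by simp
next
  case (step1 k)
  let ?y = "\<lambda>n. x (n + k)"
  have y: "?y \<in> X" "G ?y = (\<lambda>n. G x (n + k))" using step1 by blast+
  have "G (shift ?y) = shift (G ?y)" using G y(1) by (simp add: shift_endomorphism_def)
  then have "G (shift ?y) = (\<lambda>n. G x (n + (k + 1)))"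
    unfolding y(2) by (simp add: shift_def add.assoc add.commute[of 1])
  moreover have "shift ?y = (\<lambda>n. x (n + (k + 1)))"
    by (simp add: shift_def add.assoc add.commute[of 1])
  ultimately show ?case using subshift_shift[OF X y(1)] by simp
next
  case (step2 k)
  let ?y = "\<lambda>n. x (n + k)"
  have y: "?y \<in> X" "G ?y = (\<lambda>n. G x (n + k))" using step2 by blast+
  have "?y \<in> shift ` X" using X y(1) by (simp add: subshift_def)
  then obtain z where z: "?y = shift z" "z \<in> X" by (rule imageE)
  have "z n = x (n + (k - 1))" for n
    using fun_cong[OF z(1), of "n - 1"] by (simp add: shift_def algebra_simps)
  then have z_eq: "z = (\<lambda>n. x (n + (k - 1)))" by (rule ext)
  have "shift (G z) = G ?y" using G z by (simp add: shift_endomorphism_def)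
  from fun_cong[OF this, of "n - 1" for n] have "G z n = G x (n + (k - 1))" for n
    unfolding y(2) by (simp add: shift_def algebra_simps)
  then have "G z = (\<lambda>n. G x (n + (k - 1)))" by (rule ext)
  then show ?case using z(2) unfolding z_eq by (rule conjI[rotated])
qed

lemma shift_endomorphism_comp_translate:
  assumes X: "subshift X" and G: "shift_endomorphism X G"
  shows "shift_endomorphism X (\<lambda>x n. G x (n + k))"
proof -
  have cont: "continuous_on X G" and into: "\<And>x. x \<in> X \<Longrightarrow> G x \<in> X"
    and comm: "\<And>x. x \<in> X \<Longrightarrow> G (shift x) = shift (G x)"
    using G unfolding shift_endomorphism_def by blast+
  have "continuous_on X (\<lambda>x. G x (n + k))" for n
    using cont by (rule continuous_on_product_then_coordinatewise)
  then have "continuous_on X (\<lambda>x n. G x (n + k))"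
    by (rule continuous_on_coordinatewise_then_product)
  moreover have "(\<lambda>n. G x (n + k)) \<in> X" if x: "x \<in> X" for x
  proof -
    have "(\<lambda>n. x (n + k)) \<in> X" "G (\<lambda>n. x (n + k)) = (\<lambda>n. G x (n + k))"
      using shift_endomorphism_translate[OF X G x] by blast+
    then show ?thesis using into by metis
  qed
  moreover have "(\<lambda>n. G (shift x) (n + k)) = shift (\<lambda>n. G x (n + k))" if x: "x \<in> X" for x
    unfolding comm[OF x] by (simp add: shift_def add.assoc add.commute[of 1])
  ultimately show ?thesis unfolding shift_endomorphism_def by blast
qed

section \<open>Endomorphisms of the admissible subshift\<close>

locale rich_primitive_set =
  fixes B :: "nat set"
  assumes zero_notin: "0 \<notin> B" and one_notin: "1 \<notin> B" and primitive: "primitive B"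
    and rich: "\<exists>C\<subseteq>B. infinite C \<and> pairwise coprime C"
begin

abbreviation X :: "(int \<Rightarrow> bool) set" where
  "X \<equiv> admissible_shift B"

abbreviation point :: "int \<Rightarrow> bool" where
  "point \<equiv> (\<lambda>n. n = 0)"

lemma subshift_X: "subshift X"
  by (rule subshift_admissible_shift[OF zero_notin])

lemma in_X_iff: "(\<lambda>n. n \<in> A) \<in> X \<longleftrightarrow> admissible B A"
  by (simp add: admissible_shift_def support_def)

lemma hereditary:
  assumes "x \<in> X" "\<And>n. y n \<Longrightarrow> x n"
  shows "y \<in> X"
proof -
  have "\<exists>r\<in>{0..<int b}. \<forall>n\<in>support y. n mod int b \<noteq> r" if b: "b \<in> B" for b
  proof -
    obtain r where "r \<in> {0..<int b}" "\<forall>n\<in>support x. n mod int b \<noteq> r"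
      using assms(1) b by (auto simp: admissible_shift_def admissible_iff_omits_residue[OF zero_notin])
    then show ?thesis using assms(2) by (intro bexI[of _ r]) (auto simp: support_def)
  qed
  then show ?thesis
    by (simp add: admissible_shift_def admissible_iff_omits_residue[OF zero_notin])
qed

lemma point_in_X: "point \<in> X"
proof -
  have "1 < b" if "b \<in> B" for b
    using that zero_notin one_notin by (metis nat_neq_iff less_one)
  then show ?thesis by (simp add: admissible_shift_def admissible_def support_def)
qed

lemma omits_residue:
  assumes "x \<in> X" "b \<in> B"
  shows "\<exists>r. \<forall>n. x n \<longrightarrow> \<not> [n = r] (mod int b)"
proof -
  obtain r where "r \<in> {0..<int b}" "\<forall>n\<in>support x. n mod int b \<noteq> r"
    using assms by (auto simp: admissible_shift_def admissible_iff_omits_residue[OF zero_notin])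
  then show ?thesis
    by (intro exI[of _ r]) (auto simp: support_def cong_def)
qed

text \<open>
  If the image of the single point under \<open>G\<close> has ones on \<open>S\<close>, then, by continuity and
  equivariance, the image of a configuration has ones on \<open>p + S\<close> whenever \<open>p\<close> is
  sufficiently isolated in its support. Applied to the set of \<open>extend_to_cover\<close>, this produces
  an image \<open>G z\<close> whose support meets almost all residues modulo \<open>b\<close>, while the coordinate
  \<open>n\<close> of the image does not notice that points were added to \<open>A\<close>. The purpose is to
  contradict \<open>omits_residue\<close> for \<open>G z\<close>.
\<close>

lemma endomorphism_almost_covers:
  fixes A S :: "int set" and s n :: int and K :: nat
  assumes G: "shift_endomorphism X G"
    and S: "finite S" "\<And>k. k \<in> S \<Longrightarrow> G point k"
    and A: "finite A" "admissible B A" "s \<notin> A"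
  obtains b z where "b \<in> B" "K < b" "z \<in> X" "G z n = G (\<lambda>i. i \<in> A) n"
    "\<And>k t. k \<in> S \<Longrightarrow> \<not> [t = s] (mod int b) \<Longrightarrow> \<exists>u. [u = t + k] (mod int b) \<and> G z u"
proof -
  have cont: "continuous_on X G" using G by (simp add: shift_endomorphism_def)
  obtain m\<^sub>A where m\<^sub>A: "\<And>y. y \<in> X \<Longrightarrow> (\<And>i. \<bar>i\<bar> \<le> m\<^sub>A \<Longrightarrow> y i = (i \<in> A)) \<Longrightarrow> G y n = G (\<lambda>i. i \<in> A) n"
    using continuous_on_imp_locally_determined[OF cont, of "\<lambda>i. i \<in> A" n] A(2) in_X_iff by blast
  have "\<forall>k\<in>S. \<exists>m. \<forall>y\<in>X. (\<forall>i. \<bar>i\<bar> \<le> m \<longrightarrow> y i = (i = 0)) \<longrightarrow> G y k = G point k"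
    using continuous_on_imp_locally_determined[OF cont point_in_X] by blast
  from bchoice[OF this] obtain \<mu> where
    \<mu>: "\<forall>k\<in>S. \<forall>y\<in>X. (\<forall>i. \<bar>i\<bar> \<le> \<mu> k \<longrightarrow> y i = (i = 0)) \<longrightarrow> G y k = G point k"
    by (rule exE)
  obtain m where m: "\<And>k. k \<in> S \<Longrightarrow> \<mu> k \<le> m" "0 \<le> m"
    using bdd_above_finite[of "insert 0 (\<mu> ` S)"] S(1) by (auto simp: bdd_above_def)
  obtain C where C: "C \<subseteq> B" "infinite C" "pairwise coprime C" using rich by blast
  \<comment> \<open>New points outside \<open>W\<close> are not seen by \<open>G\<close> at the coordinate \<open>n\<close>.\<close>
  define W where "W = A \<union> {- m\<^sub>A..m\<^sub>A}"
  have "finite W" using A(1) by (simp add: W_def)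
  from extend_to_cover[OF zero_notin one_notin primitive C A this, of K m]
  obtain b T where b: "b \<in> B" "K < b" and adm: "admissible B (A \<union> T)"
    and cover: "\<And>t. \<not> [t = s] (mod int b) \<Longrightarrow> \<exists>n\<in>T. [n = t] (mod int b)"
    and sepW: "\<And>n k. n \<in> T \<Longrightarrow> k \<in> W \<Longrightarrow> m < \<bar>n - k\<bar>"
    and sepT: "\<And>n k. n \<in> T \<Longrightarrow> k \<in> T \<Longrightarrow> n \<noteq> k \<Longrightarrow> m < \<bar>n - k\<bar>"
    by metis
  define z where "z = (\<lambda>i. i \<in> A \<union> T)"
  have z: "z \<in> X" using adm unfolding z_def by (simp only: in_X_iff)
  have "z i = (i \<in> A)" if "\<bar>i\<bar> \<le> m\<^sub>A" for i
    using sepW[of i i] that m(2) by (auto simp: z_def W_def abs_le_iff)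
  then have zn: "G z n = G (\<lambda>i. i \<in> A) n" using m\<^sub>A[OF z] by blast
  have "\<exists>u. [u = t + k] (mod int b) \<and> G z u"
    if k: "k \<in> S" and t: "\<not> [t = s] (mod int b)" for k t
  proof -
    obtain p where p: "p \<in> T" "[p = t] (mod int b)" using cover[OF t] by blast
    let ?y = "\<lambda>i. z (i + p)"
    have y: "?y \<in> X" "G ?y = (\<lambda>i. G z (i + p))"
      using shift_endomorphism_translate[OF subshift_X G z] by blast+
    have "?y i = (i = 0)" if i: "\<bar>i\<bar> \<le> \<mu> k" for i
    proof -
      have im: "\<bar>i\<bar> \<le> m" using i m(1)[OF k] by linarith
      have "i = 0" if "i + p \<in> A"
        using sepW[OF p(1), of "i + p"] im that by (simp add: W_def)
      moreover have "i = 0" if "i + p \<in> T"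
        using sepT[OF p(1) that] im by force
      ultimately show ?thesis using p(1) by (auto simp: z_def)
    qed
    then have "G ?y k" using \<mu>[rule_format, OF k y(1)] S(2)[OF k] by simp
    then have "G z (k + p)" using y(2) by simp
    moreover have "[k + p = t + k] (mod int b)"
      using cong_add[OF cong_refl p(2), of k] by (simp add: add.commute)
    ultimately show ?thesis by blast
  qed
  then show ?thesis by (rule that[OF b z zn])
qed

text \<open>
  With two distinct shifts \<open>k\<close>, \<open>l\<close> at hand, the residues \<open>t + k\<close> and \<open>t + l\<close>
  with \<open>t\<close> nonzero modulo \<open>b\<close> exhaust everything as soon as \<open>b\<close> does not divide
  \<open>k - l\<close>, which no configuration of the subshift allows.
\<close>

lemma image_of_point_at_most_one:
  assumes G: "shift_endomorphism X G" and "G point k" "G point l"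
  shows "k = l"
proof (rule ccontr)
  assume ne: "k \<noteq> l"
  have "admissible B {}" using zero_notin by (auto simp: admissible_def intro!: gr0I)
  moreover have "G point j" if "j \<in> {k, l}" for j using that assms(2,3) by auto
  ultimately obtain b z where b: "b \<in> B" "nat \<bar>k - l\<bar> < b" and z: "z \<in> X"
    and cover: "\<And>j t. j \<in> {k, l} \<Longrightarrow> \<not> [t = 0] (mod int b) \<Longrightarrow> \<exists>u. [u = t + j] (mod int b) \<and> G z u"
    using endomorphism_almost_covers[OF G, of "{k, l}" "{}" 0 "nat \<bar>k - l\<bar>" 0]
    by (metis empty_iff finite.emptyI finite_insert)
  have "G z \<in> X" using G z by (auto simp: shift_endomorphism_def)
  then obtain r where r: "\<And>n. G z n \<Longrightarrow> \<not> [n = r] (mod int b)"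
    using omits_residue[OF _ b(1)] by blast
  have "int b dvd r - j" if "j \<in> {k, l}" for j
  proof (rule ccontr)
    assume "\<not> int b dvd r - j"
    then have "\<not> [r - j = 0] (mod int b)" by (simp add: cong_0_iff)
    from cover[OF that this] show False using r by auto
  qed
  then have "int b dvd k - l"
    using dvd_diff[of "int b" "r - l" "r - k"] by simp
  then show False using dvd_imp_le_int[of "k - l" "int b"] ne b(2) by auto
qed

text \<open>
  A new symbol \<open>1\<close> at \<open>n\<close> would persist when \<open>x\<close> is replaced by a finite part of it.
  The set built from that part with \<open>s = n\<close> leaves only the residue of \<open>n\<close> free, its
  added points survive under \<open>G\<close>, and the new symbol fills the last residue.
\<close>

lemma endomorphism_fixing_point_le:
  assumes G: "shift_endomorphism X G" and "G point 0" and x: "x \<in> X" and "G x n"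
  shows "x n"
proof (rule ccontr)
  assume xn: "\<not> x n"
  have "continuous_on X G" using G by (simp add: shift_endomorphism_def)
  from continuous_on_imp_locally_determined[OF this x]
  obtain m where m: "\<forall>y\<in>X. (\<forall>i. \<bar>i\<bar> \<le> m \<longrightarrow> y i = x i) \<longrightarrow> G y n = G x n"
    by (rule exE)
  define A where "A = {i. \<bar>i\<bar> \<le> m \<and> x i}"
  have A_X: "(\<lambda>i. i \<in> A) \<in> X" by (rule hereditary[OF x]) (simp add: A_def)
  have "finite A" by (rule finite_subset[of _ "{- m..m}"]) (auto simp: A_def)
  moreover have "n \<notin> A" using xn by (simp add: A_def)
  moreover have "admissible B A" using A_X in_X_iff by simp
  ultimately obtain b z where b: "b \<in> B" and z: "z \<in> X"
    and zn: "G z n = G (\<lambda>i. i \<in> A) n"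
    and cover: "\<And>t. \<not> [t = n] (mod int b) \<Longrightarrow> \<exists>u. [u = t] (mod int b) \<and> G z u"
    using endomorphism_almost_covers[OF G, of "{0}" A n 0 n] assms(2)
    by (metis add.right_neutral finite.emptyI finite_insert singleton_iff)
  have "G (\<lambda>i. i \<in> A) n = G x n" using m A_X by (simp add: A_def)
  then have "G z n" using zn assms(4) by simp
  then have all: "\<exists>u. [u = t] (mod int b) \<and> G z u" for t
    using cover[of t] cong_sym[of t n] by blast
  have "G z \<in> X" using G z by (auto simp: shift_endomorphism_def)
  then obtain r where "\<And>n. G z n \<Longrightarrow> \<not> [n = r] (mod int b)"
    using omits_residue[OF _ b] by blast
  then show False using all[of r] by blast
qed

lemma zero_in_X: "(\<lambda>n. False) \<in> X"
  by (rule hereditary[OF point_in_X]) simp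

text \<open>
  The image of the zero configuration is constant, and the constant configuration \<open>1\<close> is not
  admissible.
\<close>

lemma endomorphism_zero:
  assumes G: "shift_endomorphism X G"
  shows "G (\<lambda>n. False) = (\<lambda>n. False)"
proof
  fix n
  have inX: "G (\<lambda>n. False) \<in> X" using G zero_in_X by (auto simp: shift_endomorphism_def)
  have const: "G (\<lambda>n. False) k = G (\<lambda>n. False) n" for k
    using fun_cong[OF conjunct2[OF shift_endomorphism_translate[OF subshift_X G zero_in_X,
            of "n - k"]], of k]
    by simp
  obtain b where "b \<in> B" using rich infinite_imp_nonempty by blast
  then obtain r where "\<forall>n. G (\<lambda>n. False) n \<longrightarrow> \<not> [n = r] (mod int b)"
    using omits_residue[OF inX] by blast
  then have "\<not> G (\<lambda>n. False) r" using cong_refl by blast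
  then show "G (\<lambda>n. False) n = False" using const[of r] by simp
qed

text \<open>
  After composing with a power of the shift, both \<open>F\<close> and its inverse fix the single point,
  so neither can enlarge a support; hence neither can shrink one.
\<close>

lemma automorphism_is_shift_power:
  assumes F: "shift_endomorphism X F" and G: "shift_endomorphism X G"
    and GF: "\<And>x. x \<in> X \<Longrightarrow> G (F x) = x"
  shows "\<exists>k. \<forall>x\<in>X. F x = (\<lambda>n. x (n + k))"
proof -
  have FX: "F x \<in> X" if "x \<in> X" for x using F that by (auto simp: shift_endomorphism_def)
  have "F point \<noteq> (\<lambda>n. False)"
  proof
    assume "F point = (\<lambda>n. False)"
    then have "point = (\<lambda>n. False)"
      using GF[OF point_in_X] endomorphism_zero[OF G] by simp
    from fun_cong[OF this, of 0] show False by simp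
  qed
  then obtain k where "F point k" by (auto simp: fun_eq_iff)
  then have F_point: "F point = (\<lambda>n. n = k)"
    using image_of_point_at_most_one[OF F] by auto
  let ?F = "\<lambda>x n. F x (n + k)" and ?G = "\<lambda>x n. G x (n + - k)"
  have F': "shift_endomorphism X ?F" and G': "shift_endomorphism X ?G"
    using shift_endomorphism_comp_translate[OF subshift_X] F G by blast+
  have GF': "?G (?F x) = x" if x: "x \<in> X" for x
    using shift_endomorphism_translate[OF subshift_X G FX[OF x], of k] GF[OF x] by auto
  have F_fix: "?F point = point" by (auto simp: F_point)
  have G_fix: "?G point = point" using GF'[OF point_in_X] by (simp only: F_fix)
  have F_id: "?F x = x" if x: "x \<in> X" for x
  proof
    fix n
    have F'X: "?F x \<in> X" using F' x by (auto simp: shift_endomorphism_def)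
    have "?F x n \<Longrightarrow> x n"
      using endomorphism_fixing_point_le[OF F' _ x] fun_cong[OF F_fix, of 0] by simp
    moreover have "x n \<Longrightarrow> ?F x n"
      using endomorphism_fixing_point_le[OF G' _ F'X, of n] fun_cong[OF G_fix, of 0]
        fun_cong[OF GF'[OF x], of n] by simp
    ultimately show "?F x n = x n" by blast
  qed
  have eq: "F x = (\<lambda>n. x (n + - k))" if x: "x \<in> X" for x
  proof
    fix n
    show "F x n = x (n + - k)" using fun_cong[OF F_id[OF x], of "n + - k"] by simp
  qed
  show ?thesis by (intro exI[of _ "- k"] ballI eq)
qed

end

theorem corollary4p2:
  fixes B :: "nat set"
  assumes "B \<subseteq> {1..} - {1}"
    and "primitive B"
    and "\<exists>C\<subseteq>B. infinite C \<and> pairwise coprime C"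
  shows "Aut (admissible_shift B) =
    {restrict (int_iterate shift n) (admissible_shift B) | n :: int. True}"
proof -
  interpret rich_primitive_set B
  proof
    show "0 \<notin> B" "1 \<notin> B" using assms(1) by auto
  qed (rule assms)+
  let ?R = "\<lambda>n. restrict (int_iterate shift n) X"
  show ?thesis
  proof (intro subset_antisym subsetI)
    fix F assume F: "F \<in> Aut X"
    then obtain G where hom: "homeomorphism X X F G" and ext: "F \<in> extensional X"
      and comm: "\<And>x. x \<in> X \<Longrightarrow> F (shift x) = shift (F x)"
      by (auto simp: Aut_def)
    have endF: "shift_endomorphism X F"
      using hom comm by (auto simp: shift_endomorphism_def homeomorphism_def)
    have "G (shift y) = shift (G y)" if y: "y \<in> X" for y
    proof -
      have Gy: "G y \<in> X" using hom y by (auto simp: homeomorphism_def)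
      then have "shift (G y) \<in> X" using subshift_X by (auto simp: subshift_def)
      moreover have "F (shift (G y)) = shift y"
        using comm[OF Gy] hom y by (simp add: homeomorphism_def)
      ultimately show ?thesis using hom unfolding homeomorphism_def by metis
    qed
    then have endG: "shift_endomorphism X G"
      using hom by (auto simp: shift_endomorphism_def homeomorphism_def)
    have "\<And>x. x \<in> X \<Longrightarrow> G (F x) = x" using hom by (simp add: homeomorphism_def)
    from automorphism_is_shift_power[OF endF endG this]
    obtain k where "\<forall>x\<in>X. F x = (\<lambda>n. x (n + k))" by blast
    then have "F = ?R k"
      using ext by (intro extensionalityI[of _ X]) (auto simp: int_iterate_shift)
    then show "F \<in> {?R n |n. True}" by blast
  next
    fix F assume "F \<in> {?R n |n. True}"
    then obtain k where F: "F = ?R k" by blast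
    have "shift_endomorphism X (\<lambda>x. x)" by (simp add: shift_endomorphism_def)
    note endo = shift_endomorphism_comp_translate[OF subshift_X this]
    have shX: "shift x \<in> X" if "x \<in> X" for x
      using that subshift_X by (auto simp: subshift_def)
    have R: "?R j x = (\<lambda>n. x (n + j))" if "x \<in> X" for j x
      using that by (simp add: int_iterate_shift)
    have inX: "(\<lambda>n. x (n + j)) \<in> X" if "x \<in> X" for j x
      using endo[of j] that by (auto simp: shift_endomorphism_def)
    have cont: "continuous_on X (?R j)" for j
      using endo[of j] R by (simp add: shift_endomorphism_def cong: continuous_on_cong)
    have Rin: "?R j ` X \<subseteq> X" for j using R inX by auto
    have inverse: "?R i (?R j x) = x" if "x \<in> X" "i + j = 0" for i j x
      using that(2) by (simp only: R[OF that(1)] R[OF inX[OF that(1)]] add.assoc) simp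
    have "homeomorphism X X (?R k) (?R (- k))"
      by (intro homeomorphismI cont Rin inverse) simp_all
    moreover have "?R k (shift x) = shift (?R k x)" if "x \<in> X" for x
      using R[OF that] R[OF shX[OF that]] by (simp add: shift_def algebra_simps)
    ultimately show "F \<in> Aut X" unfolding F Aut_def by auto
  qed
qed

end
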